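(* Let $\lambda$ be an integer partition. If $\lambda$ is Latin, then $\lambda$ is strongly Latin.
   Context: A tableau of shape $\lambda$ is the Young diagram of $\lambda$ (row $i$ has $\lambda_i$ cells, cell $(i,j)$ exists iff $j\le\lambda_i$) with a positive integer in each cell; no semistandardness is assumed. $\lambda'$ denotes the conjugate partition. A Latin tableau of shape $\lambda$ and content $\mu$ is a tableau of shape $\lambda$ in which no two cells in the same row or the same column have the same entry, and the total number of occurrences of the integer $i$ equals $\mu_i$ for every $i$. The partition $\lambda$ is Latin if there exists a Latin tableau of shape $\lambda$ and content $\lambda'$. The partition $\lambda$ is strongly Latin if for every sequence $(I_i)_{i=1}^{\ell(\lambda)}$ of sets of integers with $|I_i|=\lambda_i$ for all $i$, there exists a tableau $T$ of shape $\lambda$ (entries integers) such that (a) for every $i$ the set of entries in row $i$ of $T$ is exactly $I_i$, and (b) for every $j$ the entries in column $j$ of $T$ are pairwise distinct. *)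

theory Defs
  imports Main
begin

definition is_partition :: "nat list \<Rightarrow> bool" where
  "is_partition la \<longleftrightarrow> sorted_wrt (\<ge>) la \<and> 0 \<notin> set la"

text \<open>Parts, rows, columns and cells are indexed from 1; parts beyond the length are 0.\<close>

definition part :: "nat list \<Rightarrow> nat \<Rightarrow> nat" where
  "part la i = (if 1 \<le> i \<and> i \<le> length la then la ! (i - 1) else 0)"

definition cells :: "nat list \<Rightarrow> (nat \<times> nat) set" where
  "cells la = {(i, j). 1 \<le> i \<and> i \<le> length la \<and> 1 \<le> j \<and> j \<le> part la i}"

definition conjugate :: "nat list \<Rightarrow> nat list" where
  "conjugate la = map (\<lambda>j. card {i. (i, j) \<in> cells la}) [1..<Suc (part la 1)]"

text \<open>
  A tableau of shape \<open>la\<close> is a function of the row and column index, of which only the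
  values on \<open>cells la\<close> matter.
\<close>

definition latin_tableau :: "nat list \<Rightarrow> nat list \<Rightarrow> (nat \<Rightarrow> nat \<Rightarrow> nat) \<Rightarrow> bool" where
  "latin_tableau la mu T \<longleftrightarrow>
     (\<forall>(i, j) \<in> cells la. 0 < T i j) \<and>
     (\<forall>i. inj_on (\<lambda>j. T i j) {j. (i, j) \<in> cells la}) \<and>
     (\<forall>j. inj_on (\<lambda>i. T i j) {i. (i, j) \<in> cells la}) \<and>
     (\<forall>k\<ge>1. card {(i, j) \<in> cells la. T i j = k} = part mu k)"

definition latin :: "nat list \<Rightarrow> bool" where
  "latin la \<longleftrightarrow> (\<exists>T. latin_tableau la (conjugate la) T)"

definition strongly_latin :: "nat list \<Rightarrow> bool" where
  "strongly_latin la \<longleftrightarrow>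
     (\<forall>I :: nat \<Rightarrow> int set.
        (\<forall>i\<in>{1..length la}. finite (I i) \<and> card (I i) = part la i) \<longrightarrow>
        (\<exists>T :: nat \<Rightarrow> nat \<Rightarrow> int.
           (\<forall>i\<in>{1..length la}. (\<lambda>j. T i j) ` {j. (i, j) \<in> cells la} = I i) \<and>
           (\<forall>j. inj_on (\<lambda>i. T i j) {i. (i, j) \<in> cells la})))"

lemma finite_cells_column: "finite {i. (i, j) \<in> cells la}"
  by (rule finite_subset[of _ "{..length la}"]) (auto simp: cells_def)

lemma is_partition_conjugate:
  assumes "is_partition la"
  shows "is_partition (conjugate la)"
proof -
  have "card {i. (i, b) \<in> cells la} \<le> card {i. (i, a) \<in> cells la}" if "1 \<le> a" "a < b" for a b
    by (rule card_mono[OF finite_cells_column]) (use that in \<open>auto simp: cells_def\<close>)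
  hence "sorted_wrt (\<ge>) (conjugate la)"
    unfolding conjugate_def sorted_wrt_map
    by (intro sorted_wrt_mono_rel[OF _ sorted_wrt_upt]) auto
  moreover have "card {i. (i, j) \<in> cells la} \<noteq> 0" if "1 \<le> j" "j \<le> part la 1" for j
  proof -
    have "1 \<in> {i. (i, j) \<in> cells la}"
      using that by (auto simp: cells_def part_def split: if_splits)
    thus ?thesis using finite_cells_column[of j la] by auto
  qed
  ultimately show ?thesis
    by (fastforce simp: is_partition_def conjugate_def)
qed

end

theory Submission imports Defs begin

text \<open>
  If \<open>T\<close> is a Latin tableau of shape \<open>\<lambda>\<close> and content \<open>\<lambda>'\<close>, then counting the entries at most \<open>k\<close>
  row by row shows that row \<open>i\<close> of \<open>T\<close> has its entries in \<open>{1..\<lambda>\<^sub>i}\<close>. Finding the tableau required by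
  strong Latinity means properly colouring the cells from the lists \<open>I\<^sub>i\<close>, where cells in a common
  row or column conflict. Galvin's kernel method applies: orient conflicts towards the larger entry
  of \<open>T\<close> in rows and towards the smaller entry in columns. A cell of row \<open>i\<close> with entry \<open>t\<close> then has at
  most \<open>\<lambda>\<^sub>i - t\<close> out-neighbours in its row and \<open>t - 1\<close> in its column, hence fewer than its list size
  \<open>\<lambda>\<^sub>i\<close>, and every set of cells has a kernel, by a stable matching argument.
\<close>

section \<open>Kernels and list colouring for conflicts along rows and columns\<close>

definition collinear :: "'a \<times> 'b \<Rightarrow> 'a \<times> 'b \<Rightarrow> bool" where
  "collinear c d \<longleftrightarrow> fst c = fst d \<or> snd c = snd d"

text \<open>Serves twice: for a ranking \<open>f\<close> it rules out ties between conflicting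
  cells, for a colouring \<open>g\<close> it is properness.\<close>

definition inj_on_lines :: "('a \<times> 'b \<Rightarrow> 'c) \<Rightarrow> ('a \<times> 'b) set \<Rightarrow> bool" where
  "inj_on_lines f S \<longleftrightarrow> (\<forall>c\<in>S. \<forall>d\<in>S. collinear c d \<longrightarrow> f c = f d \<longrightarrow> c = d)"

definition out_nbrs :: "('a \<times> 'b \<Rightarrow> 'c::linorder) \<Rightarrow> ('a \<times> 'b) set \<Rightarrow> 'a \<times> 'b \<Rightarrow> ('a \<times> 'b) set" where
  "out_nbrs f S c =
     {d \<in> S. fst d = fst c \<and> f c < f d} \<union> {d \<in> S. snd d = snd c \<and> f d < f c}"

text \<open>Read a cell as an edge joining its row to its column. If rows prefer large and columns
  prefer small values of \<open>f\<close>, and conflicting cells never tie, a kernel is a stable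
  matching of this bipartite graph.\<close>

definition kernel :: "('a \<times> 'b \<Rightarrow> 'c::linorder) \<Rightarrow> ('a \<times> 'b) set \<Rightarrow> ('a \<times> 'b) set \<Rightarrow> bool" where
  "kernel f S K \<longleftrightarrow> K \<subseteq> S \<and> (\<forall>c\<in>K. \<forall>d\<in>K. collinear c d \<longrightarrow> c = d) \<and>
     (\<forall>c\<in>S - K. out_nbrs f K c \<noteq> {})"

lemma inj_on_lines_subset: "inj_on_lines f S \<Longrightarrow> A \<subseteq> S \<Longrightarrow> inj_on_lines f A"
  by (auto simp: inj_on_lines_def)

text \<open>Deferred acceptance of Gale and Shapley, phrased as an induction on \<open>S\<close>.
  The set \<open>R\<close> collects the favourite cells of the rows. If they lie in distinct
  columns, they form a kernel. Otherwise some column prefers \<open>c\<close> to another favourite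
  \<open>d\<close>, and \<open>d\<close> can be deleted, since a kernel of the rest absorbs
  \<open>d\<close> as well.\<close>

lemma kernel_exists:
  assumes "finite S" and "inj_on_lines f S"
  shows "\<exists>K. kernel f S K"
  using assms
proof (induction S rule: finite_psubset_induct)
  case (psubset S)
  define R where "R = {c \<in> S. \<forall>d\<in>S. fst d = fst c \<longrightarrow> f d \<le> f c}"
  have inj: "c = d" if "c \<in> S" "d \<in> S" "collinear c d" "f c = f d" for c d
    using psubset.prems that by (auto simp: inj_on_lines_def)
  have row_max: "\<exists>d\<in>R. fst d = fst c \<and> f c \<le> f d" if "c \<in> S" for c
  proof -
    let ?M = "{d \<in> S. fst d = fst c}"
    have fin: "finite (f ` ?M)" using psubset.hyps by simp
    have ne: "f ` ?M \<noteq> {}" using that by blast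
    from Max_in[OF fin ne] obtain d where d: "d \<in> ?M" "f d = Max (f ` ?M)"
      by (metis (no_types, lifting) imageE)
    have "f e \<le> f d" if "e \<in> ?M" for e
      unfolding d(2) using that by (intro Max_ge[OF fin] imageI)
    thus ?thesis using d(1) that by (intro bexI[of _ d]) (simp_all add: R_def)
  qed
  show ?case
  proof (cases "\<exists>c\<in>R. \<exists>d\<in>R. snd c = snd d \<and> c \<noteq> d")
    case False
    have "kernel f S R"
      unfolding kernel_def
    proof (intro conjI ballI impI)
      show "R \<subseteq> S" by (auto simp: R_def)
      show "c = d" if cd: "c \<in> R" "d \<in> R" "collinear c d" for c d
      proof (cases "snd c = snd d")
        case True
        thus ?thesis using cd False by blast
      next
        case False
        hence "fst c = fst d" using cd by (simp add: collinear_def)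
        hence "f c = f d" using cd by (intro antisym) (simp_all add: R_def)
        thus ?thesis using inj[of c d] cd by (simp add: R_def)
      qed
      show "out_nbrs f R c \<noteq> {}" if "c \<in> S - R" for c
      proof -
        from that row_max[of c] obtain d where d: "d \<in> R" "fst d = fst c" "f c \<le> f d" by auto
        moreover have "f c \<noteq> f d"
          using inj[of c d] d that by (auto simp: R_def collinear_def)
        ultimately have "d \<in> out_nbrs f R c" by (simp add: out_nbrs_def order_less_le)
        thus ?thesis by blast
      qed
    qed
    thus ?thesis ..
  next
    case True
    then obtain a b where ab: "a \<in> R" "b \<in> R" "snd a = snd b" "a \<noteq> b" by blast
    hence "f a \<noteq> f b" using inj[of a b] by (auto simp: R_def collinear_def)
    then consider "f a < f b" | "f b < f a" by (rule linorder_neqE)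
    then obtain c d where cd: "c \<in> R" "d \<in> R" "snd c = snd d" "f c < f d"
      using ab that[of a b] that[of b a] by cases simp_all
    have S: "c \<in> S" "d \<in> S" "c \<noteq> d" using cd by (auto simp: R_def)
    have "S - {d} \<subset> S" using S by auto
    then obtain K where K: "kernel f (S - {d}) K"
      using psubset.IH inj_on_lines_subset[OF psubset.prems] by blast
    \<comment> \<open>As \<open>c\<close> is maximal in its row, its out-neighbours lie in its column, where they are also
      out-neighbours of \<open>d\<close>.\<close>
    have "out_nbrs f K d \<noteq> {}"
    proof (cases "c \<in> K")
      case True
      hence "c \<in> out_nbrs f K d" using cd by (simp add: out_nbrs_def)
      thus ?thesis by blast
    next
      case False
      then obtain e where e: "e \<in> out_nbrs f K c"
        using K S unfolding kernel_def by blast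
      have "e \<in> S" using K e by (auto simp: kernel_def out_nbrs_def)
      hence "\<not> (fst e = fst c \<and> f c < f e)" using cd(1) by (simp add: R_def leD)
      hence "e \<in> K" "snd e = snd c" "f e < f c"
        using e unfolding out_nbrs_def by blast+
      hence "e \<in> out_nbrs f K d"
        using cd(3) less_trans[OF _ cd(4)] by (simp add: out_nbrs_def)
      thus ?thesis by blast
    qed
    hence "kernel f S K" using K unfolding kernel_def by blast
    thus ?thesis ..
  qed
qed

text \<open>Give one colour \<open>x\<close> to a kernel \<open>K\<close> of the cells whose lists
  contain \<open>x\<close>, then delete \<open>K\<close> and \<open>x\<close>. A remaining list
  shrinks only if it contained \<open>x\<close>; its cell then also loses an out-neighbour in
  \<open>K\<close>, so the strict inequality survives.\<close>

lemma galvin_list_colouring: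
  fixes L :: "'a \<times> 'b \<Rightarrow> 'c set"
  assumes "finite S" and "inj_on_lines f S"
    and "\<And>c. c \<in> S \<Longrightarrow> finite (L c)"
    and "\<And>c. c \<in> S \<Longrightarrow> card (out_nbrs f S c) < card (L c)"
  shows "\<exists>g. (\<forall>c\<in>S. g c \<in> L c) \<and> inj_on_lines g S"
  using assms
proof (induction S arbitrary: L rule: finite_psubset_induct)
  case (psubset S)
  show ?case
  proof (cases "S = {}")
    case True
    thus ?thesis by (auto simp: inj_on_lines_def)
  next
    case False
    then obtain c0 where "c0 \<in> S" by auto
    with psubset.prems(3)[of c0] obtain x where x: "x \<in> L c0"
      by (metis card.empty ex_in_conv not_less_zero)
    let ?Sx = "{c \<in> S. x \<in> L c}"
    have "finite ?Sx" using psubset.hyps by auto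
    moreover have "inj_on_lines f ?Sx"
      by (rule inj_on_lines_subset[OF psubset.prems(1)]) auto
    ultimately obtain K where K: "kernel f ?Sx K"
      using kernel_exists by blast
    have KS: "K \<subseteq> S" "\<And>c. c \<in> K \<Longrightarrow> x \<in> L c" using K by (auto simp: kernel_def)
    \<comment> \<open>An empty kernel could not absorb \<open>c0\<close>, so the induction makes
      progress.\<close>
    have "K \<noteq> {}" using K x \<open>c0 \<in> S\<close> by (auto simp: kernel_def out_nbrs_def)
    hence sub: "S - K \<subset> S" using KS by auto
    have fin: "finite (out_nbrs f S c)" for c
      using psubset.hyps by (auto simp: out_nbrs_def)
    have deg: "card (out_nbrs f (S - K) c) < card (L c - {x})" if c: "c \<in> S - K" for c
    proof (cases "x \<in> L c")
      case True
      then obtain d where d: "d \<in> out_nbrs f K c"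
        using K c unfolding kernel_def by blast
      \<comment> \<open>The absorbing cell \<open>d\<close> witnesses that the inclusion is
        strict.\<close>
      have "out_nbrs f (S - K) c \<subset> out_nbrs f S c"
        using d KS(1) by (auto simp: out_nbrs_def)
      hence "card (out_nbrs f (S - K) c) < card (out_nbrs f S c)"
        by (rule psubset_card_mono[OF fin])
      moreover have "card (L c - {x}) = card (L c) - 1"
        using True by simp
      ultimately show ?thesis using psubset.prems(3)[of c] c by simp
    next
      case False
      have "card (out_nbrs f (S - K) c) \<le> card (out_nbrs f S c)"
        by (rule card_mono[OF fin]) (auto simp: out_nbrs_def)
      thus ?thesis using False psubset.prems(3)[of c] c by simp
    qed
    have "\<exists>g. (\<forall>c\<in>S - K. g c \<in> L c - {x}) \<and> inj_on_lines g (S - K)"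
      using sub inj_on_lines_subset[OF psubset.prems(1)] psubset.prems(2) deg
      by (intro psubset.IH) auto
    then obtain g where g: "\<And>c. c \<in> S - K \<Longrightarrow> g c \<in> L c - {x}" "inj_on_lines g (S - K)"
      by blast
    let ?g = "\<lambda>c. if c \<in> K then x else g c"
    have "\<forall>c\<in>S. ?g c \<in> L c" using g(1) KS(2) by auto
    moreover have "inj_on_lines ?g S"
      unfolding inj_on_lines_def
    proof (intro ballI impI)
      fix c d assume cd: "c \<in> S" "d \<in> S" "collinear c d" "?g c = ?g d"
      \<comment> \<open>Outside \<open>K\<close> the colour \<open>x\<close> has left the lists, so
        equal colours never link \<open>K\<close> to its complement. Inside \<open>K\<close>,
        independence settles the claim.\<close>
      have "c \<in> K \<longleftrightarrow> d \<in> K" using cd g(1)[of c] g(1)[of d] by (auto split: if_splits)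
      thus "c = d" using cd g(2) K by (auto simp: kernel_def inj_on_lines_def)
    qed
    ultimately show ?thesis by (intro exI[of _ ?g]) simp
  qed
qed

section \<open>Counting cells, and the bound on the entries of a Latin tableau\<close>

lemma card_level_sets:
  fixes f :: "'a \<Rightarrow> nat"
  assumes "finite S" and "\<And>c. c \<in> S \<Longrightarrow> 1 \<le> f c"
  shows "card {c \<in> S. f c \<le> k} = (\<Sum>s = 1..k. card {c \<in> S. f c = s})"
proof -
  have "{c \<in> S. f c \<le> k} = (\<Union>s\<in>{1..k}. {c \<in> S. f c = s})"
    using assms(2) by auto
  also have "card \<dots> = (\<Sum>s = 1..k. card {c \<in> S. f c = s})"
    using assms(1) by (intro card_UN_disjoint) auto
  finally show ?thesis .
qed

lemma finite_cells: "finite (cells la)"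
proof -
  have "cells la = Sigma {1..length la} (\<lambda>i. {1..part la i})"
    by (auto simp: cells_def)
  thus ?thesis by simp
qed

lemma cells_row: "{j. (i, j) \<in> cells la} = {1..part la i}"
  by (auto simp: cells_def part_def)

lemma card_cells_by_rows:
  "card {c \<in> cells la. P c} = (\<Sum>i = 1..length la. card {j \<in> {1..part la i}. P (i, j)})"
proof -
  have "{c \<in> cells la. P c} = Sigma {1..length la} (\<lambda>i. {j \<in> {1..part la i}. P (i, j)})"
    by (auto simp: cells_def)
  thus ?thesis by simp
qed

text \<open>Turns the content condition into a comparison of two fillings: \<open>T\<close> and the
  filling by column indices have level sets of equal size.\<close>

lemma part_conjugate:
  assumes "is_partition la" and "1 \<le> k"
  shows "part (conjugate la) k = card {c \<in> cells la. snd c = k}"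
proof -
  have "bij_betw fst {c \<in> cells la. snd c = k} {i. (i, k) \<in> cells la}"
    by (rule bij_betw_byWitness[where f' = "\<lambda>i. (i, k)"]) auto
  hence eq: "card {c \<in> cells la. snd c = k} = card {i. (i, k) \<in> cells la}"
    by (rule bij_betw_same_card)
  show ?thesis
  proof (cases "k \<le> part la 1")
    case True
    have "[1..<Suc (part la 1)] ! (k - 1) = k"
      using nth_upt[of 1 "k - 1" "Suc (part la 1)"] True assms(2) by linarith
    with True show ?thesis
      unfolding part_def[of "conjugate la"] using eq assms(2)
      by (simp add: conjugate_def del: upt_Suc)
  next
    case False
    \<comment> \<open>Row 1 is a longest row, so for larger \<open>k\<close> column \<open>k\<close>
      is empty, matching the default value 0 of \<open>part\<close>.\<close>
    have "part la i \<le> part la 1" for i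
      using assms(1) by (cases "i = 1")
        (auto simp: is_partition_def part_def sorted_wrt_iff_nth_less)
    hence "{i. (i, k) \<in> cells la} = {}"
      using False by (fastforce simp: cells_def dest: le_trans)
    thus ?thesis
      unfolding part_def[of "conjugate la"] using False eq
      by (simp add: conjugate_def del: upt_Suc)
  qed
qed

text \<open>The entries of row \<open>r\<close> are distinct and positive, so at most
  min(\<open>k\<close>, \<open>part la r\<close>) of them are at most \<open>k\<close>. The filling
  by column indices attains this bound in every row and has the same total, so \<open>T\<close>
  attains it too. For \<open>k = part la i\<close> the bound is the whole length of row
  \<open>i\<close>.\<close>

lemma latin_tableau_entry_le:
  assumes "is_partition la" and T: "latin_tableau la (conjugate la) T"
    and ij: "(i, j) \<in> cells la"
  shows "T i j \<le> part la i"
proof -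
  define k where "k = part la i"
  let ?A = "\<lambda>r. {j \<in> {1..part la r}. T r j \<le> k}"
  let ?B = "\<lambda>r. {j \<in> {1..part la r}. j \<le> k}"
  have pos: "1 \<le> T r s" if "(r, s) \<in> cells la" for r s
    using T that by (force simp: latin_tableau_def)
  have inj: "inj_on (T r) {1..part la r}" for r
    using T by (auto simp: latin_tableau_def cells_row)
  have content: "card {c \<in> cells la. T (fst c) (snd c) = s} = card {c \<in> cells la. snd c = s}"
    if "1 \<le> s" for s
    using T that part_conjugate[OF assms(1) that]
    by (simp add: latin_tableau_def case_prod_unfold)
  have "(\<Sum>r = 1..length la. card (?A r)) = card {c \<in> cells la. T (fst c) (snd c) \<le> k}"
    by (simp add: card_cells_by_rows)
  also have "\<dots> = (\<Sum>s = 1..k. card {c \<in> cells la. T (fst c) (snd c) = s})"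
    using pos by (intro card_level_sets) (auto simp: finite_cells)
  also have "\<dots> = (\<Sum>s = 1..k. card {c \<in> cells la. snd c = s})"
    by (rule sum.cong) (auto simp: content)
  also have "\<dots> = card {c \<in> cells la. snd c \<le> k}"
    by (rule card_level_sets[OF finite_cells, symmetric]) (auto simp: cells_def)
  also have "\<dots> = (\<Sum>r = 1..length la. card (?B r))"
    by (simp add: card_cells_by_rows)
  finally have sums: "(\<Sum>r = 1..length la. card (?A r)) = (\<Sum>r = 1..length la. card (?B r))" .
  have le: "card (?A r) \<le> card (?B r)" if "r \<in> {1..length la}" for r
  proof -
    have "card (?A r) = card (T r ` ?A r)"
      by (rule card_image[symmetric]) (rule inj_on_subset[OF inj], auto)
    also have "\<dots> \<le> card {1..k}"
      using that pos[of r] by (intro card_mono) (auto simp: cells_def)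
    finally have "card (?A r) \<le> k" by simp
    moreover have "card (?A r) \<le> card {1..part la r}"
      by (rule card_mono) auto
    moreover have "?B r = {1..min k (part la r)}" by auto
    ultimately show ?thesis by simp
  qed
  have i: "i \<in> {1..length la}" and j: "j \<in> {1..part la i}"
    using ij by (auto simp: cells_def)
  \<comment> \<open>Termwise inequality between equal sums forces termwise equality.\<close>
  have "card (?A i) = card (?B i)"
    by (rule sum_mono_inv[OF sums le i]) auto
  also have "?B i = {1..part la i}" by (auto simp: k_def)
  finally have "?A i = {1..part la i}"
    by (intro card_subset_eq) auto
  hence "j \<in> ?A i" using j by (rule ssubst)
  thus ?thesis by (simp add: k_def)
qed

section \<open>Out-degrees in a Latin tableau and the conclusion\<close>

lemma latin_tableau_out_nbrs:
  assumes "is_partition la" and T: "latin_tableau la (conjugate la) T"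
    and ij: "(i, j) \<in> cells la"
  shows "card (out_nbrs (\<lambda>c. T (fst c) (snd c)) (cells la) (i, j)) < part la i"
proof -
  let ?R = "{d \<in> cells la. fst d = i \<and> T i j < T (fst d) (snd d)}"
  let ?C = "{d \<in> cells la. snd d = j \<and> T (fst d) (snd d) < T i j}"
  let ?f = "\<lambda>c. T (fst c) (snd c)"
  have pos: "1 \<le> T r s" if "(r, s) \<in> cells la" for r s
    using T that by (force simp: latin_tableau_def)
  have le: "T r s \<le> part la r" if "(r, s) \<in> cells la" for r s
    using latin_tableau_entry_le[OF assms(1) T that] .
  have "card ?R \<le> card {T i j<..part la i}"
  proof (rule card_inj_on_le)
    show "inj_on ?f ?R" using T by (auto simp: latin_tableau_def inj_on_def)
  qed (use le in auto)
  moreover have "card ?C \<le> card {1..<T i j}"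
  proof (rule card_inj_on_le)
    show "inj_on ?f ?C" using T by (auto simp: latin_tableau_def inj_on_def)
  qed (use pos in auto)
  moreover have "card (?R \<union> ?C) \<le> card ?R + card ?C" by (rule card_Un_le)
  moreover have "out_nbrs ?f (cells la) (i, j) = ?R \<union> ?C"
    by (simp add: out_nbrs_def)
  \<comment> \<open>For t = \<open>T i j\<close> the two intervals have \<open>part la i\<close> - t
    and t - 1 elements. As 1 \<le> t \<le> \<open>part la i\<close>, neither difference is truncated
    and they add up to \<open>part la i\<close> - 1.\<close>
  ultimately show ?thesis using pos[OF ij] le[OF ij] by simp
qed

theorem theorem1:
  fixes la :: "nat list"
  assumes "is_partition la" and "latin la"
  shows "strongly_latin la"
  unfolding strongly_latin_def
proof (intro allI impI)
  fix I :: "nat \<Rightarrow> int set"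
  assume I: "\<forall>i\<in>{1..length la}. finite (I i) \<and> card (I i) = part la i"
  obtain T where T: "latin_tableau la (conjugate la) T"
    using assms(2) by (auto simp: latin_def)
  let ?f = "\<lambda>c. T (fst c) (snd c)"
  have "inj_on_lines ?f (cells la)"
    using T by (auto simp: latin_tableau_def inj_on_lines_def collinear_def inj_on_def)
  moreover have "card (out_nbrs ?f (cells la) c) < card (I (fst c))" if "c \<in> cells la" for c
    using that I latin_tableau_out_nbrs[OF assms(1) T, of "fst c" "snd c"]
    by (auto simp: cells_def)
  moreover have "finite (I (fst c))" if "c \<in> cells la" for c
    using that I by (auto simp: cells_def)
  ultimately obtain g where g: "\<forall>c\<in>cells la. g c \<in> I (fst c)" "inj_on_lines g (cells la)"
    using galvin_list_colouring[OF finite_cells, of ?f la "\<lambda>c. I (fst c)"] by blast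
  \<comment> \<open>Properness along row \<open>i\<close> gives as many colours as cells, which is
    the size of \<open>I i\<close>, so containment becomes equality.\<close>
  have "(\<lambda>j. g (i, j)) ` {j. (i, j) \<in> cells la} = I i" if i: "i \<in> {1..length la}" for i
  proof (rule card_subset_eq)
    show "(\<lambda>j. g (i, j)) ` {j. (i, j) \<in> cells la} \<subseteq> I i" using g(1) by auto
    have "inj_on (\<lambda>j. g (i, j)) {j. (i, j) \<in> cells la}"
      using g(2) by (force simp: inj_on_lines_def collinear_def inj_on_def)
    thus "card ((\<lambda>j. g (i, j)) ` {j. (i, j) \<in> cells la}) = card (I i)"
      using I i by (simp add: card_image) (simp add: cells_row)
  qed (use I i in auto)
  moreover have "inj_on (\<lambda>i. g (i, j)) {i. (i, j) \<in> cells la}" for j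
    using g(2) by (force simp: inj_on_lines_def collinear_def inj_on_def)
  ultimately show "\<exists>T :: nat \<Rightarrow> nat \<Rightarrow> int.
      (\<forall>i\<in>{1..length la}. (\<lambda>j. T i j) ` {j. (i, j) \<in> cells la} = I i) \<and>
      (\<forall>j. inj_on (\<lambda>i. T i j) {i. (i, j) \<in> cells la})"
    by (intro exI[of _ "\<lambda>i j. g (i, j)"]) auto
qed

end
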